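(* Let $\lambda$ be a partition with at most $n$ parts and let $\pi$ be a $\lambda$-permutation. If $\mathcal{D}_\lambda(\pi)$ equals the principal ideal $[Y_\lambda(\pi)]=\{T\in\mathcal{T}_\lambda:T\le Y_\lambda(\pi)\}$ in $\mathcal{T}_\lambda$, then $\pi$ is $\lambda$-312-avoiding. More generally: if $\mathcal{D}_\lambda(\pi)$ is a convex polytope in $\mathbb{Z}^{|\lambda|}$, then $\pi$ is $\lambda$-312-avoiding.
   Context: A set $\mathcal{D}\subseteq\mathbb{Z}^N$ is a convex polytope if it is the set of points of $\mathbb{Z}^N$ satisfying some finite system of linear inequalities. Fix $n \geq 1$; write $[m]=\{1,\dots,m\}$, $(a,b]=\{a+1,\dots,b\}$. A partition is $\lambda=(\lambda_1\ge\cdots\ge\lambda_n\ge 0)\in\mathbb{Z}^n$, $|\lambda|=\sum\lambda_i$; its shape has boxes $(j,i)$ for $1\le j\le\lambda_1$, $1\le i\le\zeta_j$, $\zeta_j=\#\{i:\lambda_i\ge j\}$. $R_\lambda\subseteq[n-1]$ is the set of column lengths less than $n$, $R_\lambda=\{q_1<\cdots<q_r\}$, $q_0=0$, $q_{r+1}=n$, carrels $(q_{h-1},q_h]$. A tableau of shape $\lambda$ is a filling $T$ with values $T_j(i)\in[n]$ strictly increasing down columns and weakly increasing along rows; $\mathcal{T}_\lambda$ is their set, ordered entrywise and viewed in $\mathbb{Z}^{|\lambda|}$. A $\lambda$-permutation is a permutation $\pi$ of $[n]$ strictly increasing on each carrel; it is $\lambda$-312-containing if there exist $h\in[r-1]$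 and $a\le q_h<b\le q_{h+1}<c\le n$ with $\pi_b<\pi_c<\pi_a$, otherwise $\lambda$-312-avoiding. For $Q\subseteq[n]$, $Y(Q)$ is the column with entries $Q$ increasing downward. With $B_h=\{\pi_1,\dots,\pi_{q_h}\}$, the $\lambda$-key $Y_\lambda(\pi)$ has columns, left to right, $\lambda_n$ copies of $Y([n])$ then, for $h=r,\dots,1$, $\lambda_{q_h}-\lambda_{q_{h+1}}$ copies of $Y(B_h)$. Scanning tableau $S(T)$: the EWIS of $x_1,x_2,\dots$ is $x_{i_1},x_{i_2},\dots$ with $i_1=1$, $i_u$ the smallest index $>i_{u-1}$ with $x_{i_u}\ge x_{i_{u-1}}$. To fill column $j$ of $S(T)$: starting with columns $j,\dots,\lambda_1$ of $T$ unmarked, repeat $\zeta_j$ times: read left to right the values of the lowest unmarked boxes of the columns still having unmarked boxes, take the EWIS, mark its boxes, and write its last value in the lowest empty box of column $j$ of $S(T)$. $\mathcal{D}_\lambda(\pi)=\{T\in\mathcal{T}_\lambda:S(T)\le Y_\lambda(\pi)\}$. *)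

theory Defs
  imports Complex_Main "HOL-Library.FuncSet" "HOL-Combinatorics.Permutations"
begin

text \<open>
  A partition with at most \<open>n\<close> parts is a function \<open>lam\<close> that is weakly decreasing on
  \<open>{1..n}\<close>; its values elsewhere are never used. The lattice \<open>\<int>\<^sup>N\<close> is rendered as
  \<open>I \<rightarrow>\<^sub>E UNIV\<close> for a finite index set \<open>I\<close> with \<open>N\<close> elements; for tableaux \<open>I\<close> is the set of
  boxes of the shape. A box \<open>(j, i)\<close> lies in column \<open>j\<close> and row \<open>i\<close>, with rows numbered
  downwards, so the lowest box of a column has the largest \<open>i\<close>.
\<close>

definition convex_polytope :: "'b set \<Rightarrow> ('b \<Rightarrow> int) set \<Rightarrow> bool" where
  "convex_polytope I D \<longleftrightarrow>
     (\<exists>F :: (('b \<Rightarrow> real) \<times> real) set. finite F \<and>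
        D = {x \<in> I \<rightarrow>\<^sub>E UNIV. \<forall>(a, c) \<in> F. (\<Sum>b\<in>I. a b * real_of_int (x b)) \<le> c})"

definition is_partition :: "nat \<Rightarrow> (nat \<Rightarrow> nat) \<Rightarrow> bool" where
  "is_partition n lam \<longleftrightarrow> antimono_on {1..n} lam"

definition col_len :: "nat \<Rightarrow> (nat \<Rightarrow> nat) \<Rightarrow> nat \<Rightarrow> nat" where
  "col_len n lam j = card {i \<in> {1..n}. j \<le> lam i}"

definition shape :: "nat \<Rightarrow> (nat \<Rightarrow> nat) \<Rightarrow> (nat \<times> nat) set" where
  "shape n lam = (SIGMA j:{1..lam 1}. {1..col_len n lam j})"

definition col_lens :: "nat \<Rightarrow> (nat \<Rightarrow> nat) \<Rightarrow> nat set" where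
  "col_lens n lam = {q \<in> col_len n lam ` {1..lam 1}. q < n}"

definition num_lens :: "nat \<Rightarrow> (nat \<Rightarrow> nat) \<Rightarrow> nat" where
  "num_lens n lam = card (col_lens n lam)"

text \<open>With \<open>r = num_lens n lam\<close>, the following is \<open>q\<^sub>h\<close> for \<open>0 \<le> h \<le> r + 1\<close>, including the
  conventions \<open>q\<^sub>0 = 0\<close> and \<open>q\<^bsub>r+1\<^esub> = n\<close>.\<close>

definition qq :: "nat \<Rightarrow> (nat \<Rightarrow> nat) \<Rightarrow> nat \<Rightarrow> nat" where
  "qq n lam h = (0 # sorted_list_of_set (col_lens n lam) @ [n]) ! h"

definition lam_permutation :: "nat \<Rightarrow> (nat \<Rightarrow> nat) \<Rightarrow> (nat \<Rightarrow> nat) \<Rightarrow> bool" where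
  "lam_permutation n lam \<pi> \<longleftrightarrow>
     \<pi> permutes {1..n} \<and>
     (\<forall>h \<in> {1..num_lens n lam + 1}. strict_mono_on {qq n lam (h - 1)<..qq n lam h} \<pi>)"

definition lam_312_containing :: "nat \<Rightarrow> (nat \<Rightarrow> nat) \<Rightarrow> (nat \<Rightarrow> nat) \<Rightarrow> bool" where
  "lam_312_containing n lam \<pi> \<longleftrightarrow>
     (\<exists>h \<in> {1..num_lens n lam - 1}. \<exists>a b c.
        1 \<le> a \<and> a \<le> qq n lam h \<and> qq n lam h < b \<and> b \<le> qq n lam (h + 1) \<and>
        qq n lam (h + 1) < c \<and> c \<le> n \<and> \<pi> b < \<pi> c \<and> \<pi> c < \<pi> a)"

definition lam_312_avoiding :: "nat \<Rightarrow> (nat \<Rightarrow> nat) \<Rightarrow> (nat \<Rightarrow> nat) \<Rightarrow> bool" where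
  "lam_312_avoiding n lam \<pi> \<longleftrightarrow> \<not> lam_312_containing n lam \<pi>"

definition tableaux :: "nat \<Rightarrow> (nat \<Rightarrow> nat) \<Rightarrow> (nat \<times> nat \<Rightarrow> int) set" where
  "tableaux n lam = {T \<in> shape n lam \<rightarrow>\<^sub>E {1..int n}.
     (\<forall>j i i'. (j, i) \<in> shape n lam \<longrightarrow> (j, i') \<in> shape n lam \<longrightarrow> i < i' \<longrightarrow> T (j, i) < T (j, i')) \<and>
     (\<forall>j j' i. (j, i) \<in> shape n lam \<longrightarrow> (j', i) \<in> shape n lam \<longrightarrow> j < j' \<longrightarrow> T (j, i) \<le> T (j', i))}"

definition tab_le ::
  "nat \<Rightarrow> (nat \<Rightarrow> nat) \<Rightarrow> (nat \<times> nat \<Rightarrow> int) \<Rightarrow> (nat \<times> nat \<Rightarrow> int) \<Rightarrow> bool" where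
  "tab_le n lam T U \<longleftrightarrow> (\<forall>b \<in> shape n lam. T b \<le> U b)"

definition principal_ideal ::
  "nat \<Rightarrow> (nat \<Rightarrow> nat) \<Rightarrow> (nat \<times> nat \<Rightarrow> int) \<Rightarrow> (nat \<times> nat \<Rightarrow> int) set" where
  "principal_ideal n lam U = {T \<in> tableaux n lam. tab_le n lam T U}"

text \<open>The columns of the key, left to right, each given by its set of entries.\<close>

definition key_cols :: "nat \<Rightarrow> (nat \<Rightarrow> nat) \<Rightarrow> (nat \<Rightarrow> nat) \<Rightarrow> nat set list" where
  "key_cols n lam \<pi> =
     replicate (lam n) {1..n} @
     concat (map (\<lambda>h. replicate (lam (qq n lam h) - lam (qq n lam (h + 1))) (\<pi> ` {1..qq n lam h}))
       (rev [1..<num_lens n lam + 1]))"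

definition lam_key :: "nat \<Rightarrow> (nat \<Rightarrow> nat) \<Rightarrow> (nat \<Rightarrow> nat) \<Rightarrow> nat \<times> nat \<Rightarrow> int" where
  "lam_key n lam \<pi> =
     (\<lambda>(j, i) \<in> shape n lam. int (sorted_list_of_set (key_cols n lam \<pi> ! (j - 1)) ! (i - 1)))"

text \<open>The earliest weakly increasing subsequence of the values \<open>f x\<close> along a list; the positions
  \<open>x\<close> themselves are returned, since the scanning procedure has to mark them.\<close>

function ewis :: "('b \<Rightarrow> int) \<Rightarrow> 'b list \<Rightarrow> 'b list" where
  "ewis f [] = []"
| "ewis f (x # xs) = x # ewis f (dropWhile (\<lambda>y. f y < f x) xs)"
  by pat_completeness auto
termination
  by (relation "measure (\<lambda>(f, xs). length xs)") (auto simp: le_imp_less_Suc length_dropWhile_le)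

definition lowest_boxes :: "nat \<Rightarrow> (nat \<times> nat) set \<Rightarrow> (nat \<times> nat) list" where
  "lowest_boxes m U = map (\<lambda>k. (k, Max (U `` {k}))) (filter (\<lambda>k. U `` {k} \<noteq> {}) [1..<m + 1])"

text \<open>\<open>unmarked n lam T j m\<close> is the set of unmarked boxes after \<open>m\<close> rounds of the procedure filling
  column \<open>j\<close>. The round performed after \<open>m\<close> previous ones fills the box in row \<open>col_len n lam j - m\<close>.\<close>

primrec unmarked ::
  "nat \<Rightarrow> (nat \<Rightarrow> nat) \<Rightarrow> (nat \<times> nat \<Rightarrow> int) \<Rightarrow> nat \<Rightarrow> nat \<Rightarrow> (nat \<times> nat) set" where
  "unmarked n lam T j 0 = {b \<in> shape n lam. j \<le> fst b}"
| "unmarked n lam T j (Suc m) =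
     unmarked n lam T j m - set (ewis T (lowest_boxes (lam 1) (unmarked n lam T j m)))"

definition scanning :: "nat \<Rightarrow> (nat \<Rightarrow> nat) \<Rightarrow> (nat \<times> nat \<Rightarrow> int) \<Rightarrow> nat \<times> nat \<Rightarrow> int" where
  "scanning n lam T =
     (\<lambda>(j, i) \<in> shape n lam.
        T (last (ewis T (lowest_boxes (lam 1) (unmarked n lam T j (col_len n lam j - i))))))"

definition demazure_tableaux ::
  "nat \<Rightarrow> (nat \<Rightarrow> nat) \<Rightarrow> (nat \<Rightarrow> nat) \<Rightarrow> (nat \<times> nat \<Rightarrow> int) set" where
  "demazure_tableaux n lam \<pi> =
     {T \<in> tableaux n lam. tab_le n lam (scanning n lam T) (lam_key n lam \<pi>)}"

end

theory Submission
  imports Defs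
begin

text \<open>
  A containing pattern yields adjacent columns \<open>j\<close>, \<open>j + 1\<close> of the key whose entry sets \<open>A \<subset> B\<close>,
  with \<open>A\<close> belonging to column \<open>j + 1\<close>, satisfy \<open>x < y < z\<close> for some \<open>x \<in> B - A\<close>, \<open>z \<in> A\<close> and
  \<open>y \<notin> B\<close>. Let \<open>x'\<close> and \<open>z'\<close> be the neighbours of \<open>y\<close> in \<open>B\<close>. There is \<open>Q \<subseteq> B - {x', z'}\<close> such
  that \<open>Q \<union> {z'}\<close> has as many elements as \<open>A\<close> and lies entrywise below \<open>A\<close>. For \<open>w = x', y, z'\<close> let
  \<open>T w\<close> agree with the key up to column \<open>j\<close> and have initial segments of the sorted \<open>Q \<union> {w}\<close> as
  its later columns. The three tableaux differ in a single row, by the value of \<open>w\<close>, so \<open>T y\<close>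
  lies on the segment from \<open>T x'\<close> to \<open>T z'\<close>. The columns of \<open>T x'\<close> and \<open>T z'\<close> are nested, hence
  these tableaux equal their scanning tableaux and lie in the Demazure set. When \<open>T y\<close> is scanned,
  the entry \<open>x'\<close> of column \<open>j\<close> is followed by \<open>y\<close>, so the scanning tableau exceeds the key.
\<close>

section \<open>Sorted lists of finite sets\<close>

text \<open>The entries at most \<open>t\<close> form an initial segment of a sorted list, so
  position \<open>i\<close> belongs to it exactly when the segment is longer than
  \<open>i\<close>.\<close>

lemma sorted_nth_le_iff:
  fixes t :: "'a::linorder"
  assumes "sorted xs" "i < length xs"
  shows "xs ! i \<le> t \<longleftrightarrow> i < length (filter (\<lambda>v. v \<le> t) xs)"
  using assms
proof (induction xs arbitrary: i)
  case Nil
  then show ?case by simp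
next
  case (Cons x xs)
  show ?case
  proof (cases "x \<le> t")
    case True
    then show ?thesis using Cons by (cases i) auto
  next
    case False
    then have none: "filter (\<lambda>v. v \<le> t) (x # xs) = []"
      using Cons.prems(1) by (auto simp: filter_empty_conv)
    have "x \<le> (x # xs) ! i"
      using Cons.prems by (cases i) auto
    with False none show ?thesis by auto
  qed
qed

lemma sorted_list_of_set_nth_le_iff:
  fixes A :: "'a::linorder set"
  assumes "finite A" "i < card A"
  shows "sorted_list_of_set A ! i \<le> t \<longleftrightarrow> i < card {v \<in> A. v \<le> t}"
proof -
  have "length (filter (\<lambda>v. v \<le> t) (sorted_list_of_set A)) = card {v \<in> A. v \<le> t}"
    using assms(1) by (subst distinct_card[symmetric]) auto
  with assms show ?thesis by (simp add: sorted_nth_le_iff)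
qed

text \<open>With \<open>t\<close> the entry of \<open>A\<close> at position \<open>i\<close>, more
  than \<open>i\<close> elements of \<open>A\<close>, hence of \<open>A'\<close>, are at most
  \<open>t\<close>. Comparing counting functions in this way avoids following positions through an
  exchange.\<close>

lemma sorted_list_of_set_nth_mono:
  fixes A A' :: "'a::linorder set"
  assumes "finite A" "finite A'" "i < card A" "i < card A'"
    and "\<And>t. card {v \<in> A. v \<le> t} \<le> card {v \<in> A'. v \<le> t}"
  shows "sorted_list_of_set A' ! i \<le> sorted_list_of_set A ! i"
proof -
  let ?t = "sorted_list_of_set A ! i"
  have "i < card {v \<in> A. v \<le> ?t}"
    using sorted_list_of_set_nth_le_iff[OF assms(1,3), of ?t] by simp
  also have "\<dots> \<le> card {v \<in> A'. v \<le> ?t}" by (rule assms(5))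
  finally show ?thesis using sorted_list_of_set_nth_le_iff[OF assms(2,4)] by blast
qed

lemma sorted_list_of_set_nth_subset:
  fixes A A' :: "'a::linorder set"
  assumes "finite A'" "A \<subseteq> A'" "i < card A"
  shows "sorted_list_of_set A' ! i \<le> sorted_list_of_set A ! i"
proof (rule sorted_list_of_set_nth_mono)
  show "finite A" using assms finite_subset by blast
  show "i < card A'" using assms card_mono by (meson order_less_le_trans)
  show "card {v \<in> A. v \<le> t} \<le> card {v \<in> A'. v \<le> t}" for t
    using assms by (intro card_mono) auto
qed (use assms in auto)

text \<open>Sending \<open>v\<close> to the smaller \<open>u\<close> and fixing everything else
  injects the elements of \<open>A\<close> up to any \<open>t\<close> into those of the new
  set.\<close>

lemma sorted_list_of_set_nth_exchange:
  fixes A :: "'a::linorder set"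
  assumes "finite A" "v \<in> A" "u \<notin> A" "u < v" "i < card A"
  shows "sorted_list_of_set (insert u (A - {v})) ! i \<le> sorted_list_of_set A ! i"
proof (rule sorted_list_of_set_nth_mono)
  show "i < card (insert u (A - {v}))"
    using assms card_Suc_Diff1[of A v] by simp
  show "card {w \<in> A. w \<le> t} \<le> card {w \<in> insert u (A - {v}). w \<le> t}" for t
  proof (rule card_inj_on_le)
    show "inj_on (\<lambda>w. if w = v then u else w) {w \<in> A. w \<le> t}"
      using assms by (auto simp: inj_on_def)
  qed (use assms in auto)
qed (use assms in auto)

lemma sorted_list_of_set_strict_eq:
  fixes xs :: "'a::linorder list"
  assumes "sorted_wrt (<) xs"
  shows "sorted_list_of_set (set xs) = xs"
  using assms by (simp add: sorted_list_of_set.idem_if_sorted_distinct strict_sorted_iff)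

lemma strict_sorted_nth_subset:
  fixes xs ys :: "'a::linorder list"
  assumes "sorted_wrt (<) xs" "sorted_wrt (<) ys" "set ys \<subseteq> set xs" "i < length ys"
  shows "xs ! i \<le> ys ! i"
proof -
  have "card (set ys) = length ys"
    using assms(2) by (simp add: distinct_card strict_sorted_iff)
  with sorted_list_of_set_nth_subset[of "set xs" "set ys" i] assms show ?thesis
    by (simp add: sorted_list_of_set_strict_eq)
qed

section \<open>Column lengths and keys\<close>

lemma col_len_antimono: "j \<le> k \<Longrightarrow> col_len n lam k \<le> col_len n lam j"
  unfolding col_len_def by (intro card_mono) auto

lemma col_len_le: "col_len n lam j \<le> n"
proof -
  have "card {i \<in> {1..n}. j \<le> lam i} \<le> card {1..n}"
    by (rule card_mono) auto
  then show ?thesis by (simp add: col_len_def)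
qed

text \<open>Monotonicity of \<open>lam\<close> makes the index set closed downwards in
  \<open>{1..n}\<close>, so it is the initial segment ending at its maximum.\<close>

lemma col_len_eq:
  assumes "is_partition n lam"
  shows "{i \<in> {1..n}. j \<le> lam i} = {1..col_len n lam j}"
proof -
  let ?S = "{i \<in> {1..n}. j \<le> lam i}"
  have down: "i' \<in> ?S" if "i \<in> ?S" "1 \<le> i'" "i' \<le> i" for i i'
  proof -
    have "lam i \<le> lam i'"
      using assms that unfolding is_partition_def by (auto simp: monotone_on_def)
    with that show ?thesis by auto
  qed
  show ?thesis
  proof (cases "?S = {}")
    case True
    then show ?thesis by (simp add: col_len_def)
  next
    case False
    define M where "M = Max ?S"
    have "M \<in> ?S" unfolding M_def using False by (intro Max_in) auto
    have "?S = {1..M}"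
    proof (intro equalityI subsetI)
      fix i assume "i \<in> ?S"
      moreover from this have "i \<le> M" unfolding M_def by (intro Max_ge) auto
      ultimately show "i \<in> {1..M}" by simp
    next
      fix i assume "i \<in> {1..M}"
      with down[OF \<open>M \<in> ?S\<close>] show "i \<in> ?S" by (meson atLeastAtMost_iff)
    qed
    then show ?thesis by (metis col_len_def card_atLeastAtMost diff_Suc_1 Suc_eq_plus1)
  qed
qed

text \<open>The duality between a partition and its conjugate; it converts statements about rows
  into statements about column lengths.\<close>

lemma le_col_len_iff:
  assumes "is_partition n lam" "1 \<le> i" "i \<le> n"
  shows "i \<le> col_len n lam j \<longleftrightarrow> j \<le> lam i"
proof -
  have "i \<in> {i \<in> {1..n}. j \<le> lam i} \<longleftrightarrow> i \<in> {1..col_len n lam j}"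
    unfolding col_len_eq[OF assms(1)] ..
  with assms(2,3) show ?thesis by simp
qed

lemma finite_col_lens: "finite (col_lens n lam)"
  by (simp add: col_lens_def)

lemma qq_in_col_lens:
  assumes "1 \<le> h" "h \<le> num_lens n lam"
  shows "qq n lam h \<in> col_lens n lam"
proof -
  have "qq n lam h = sorted_list_of_set (col_lens n lam) ! (h - 1)"
    using assms by (auto simp: qq_def nth_Cons' nth_append num_lens_def)
  then show ?thesis
    using assms finite_col_lens[of n lam]
    by (metis Suc_pred' num_lens_def One_nat_def Suc_le_eq set_sorted_list_of_set
        length_sorted_list_of_set nth_mem)
qed

lemma qq_last: "qq n lam (Suc (num_lens n lam)) = n"
  by (simp add: qq_def nth_append num_lens_def)

text \<open>Every member of \<open>col_lens\<close> is less than \<open>n\<close>, so the sorted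
  list stays strictly increasing when \<open>n\<close> is appended.\<close>

lemma qq_less:
  assumes "1 \<le> h" "h < k" "k \<le> Suc (num_lens n lam)"
  shows "qq n lam h < qq n lam k"
proof -
  have "sorted_wrt (<) (sorted_list_of_set (col_lens n lam) @ [n])"
    by (auto simp: sorted_wrt_append col_lens_def)
  then have "(sorted_list_of_set (col_lens n lam) @ [n]) ! (h - 1)
      < (sorted_list_of_set (col_lens n lam) @ [n]) ! (k - 1)"
    by (rule sorted_wrt_nth_less) (use assms in \<open>auto simp: num_lens_def\<close>)
  with assms show ?thesis by (simp add: qq_def nth_Cons')
qed

lemma col_lens_eq_qq:
  assumes "q \<in> col_lens n lam"
  obtains h where "1 \<le> h" "h \<le> num_lens n lam" "q = qq n lam h"
proof -
  from assms obtain k where "k < num_lens n lam" "sorted_list_of_set (col_lens n lam) ! k = q"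
    using finite_col_lens[of n lam]
    by (metis in_set_conv_nth num_lens_def set_sorted_list_of_set length_sorted_list_of_set)
  with that[of "Suc k"] show ?thesis by (simp add: qq_def nth_append num_lens_def)
qed

lemma qq_le:
  assumes "1 \<le> h" "h \<le> k" "k \<le> Suc (num_lens n lam)"
  shows "qq n lam h \<le> qq n lam k"
  using qq_less[of h k n lam] assms by (cases "h = k") auto

lemma col_lens_less_qq:
  assumes "q \<in> col_lens n lam" "1 \<le> h" "h \<le> num_lens n lam" "q < qq n lam (Suc h)"
  shows "q \<le> qq n lam h"
proof -
  obtain k where k: "1 \<le> k" "k \<le> num_lens n lam" "q = qq n lam k"
    using col_lens_eq_qq[OF assms(1)] by blast
  have "k \<le> h"
    using qq_le[of "Suc h" k n lam] k assms by (meson leI le_SucI not_less_eq_eq not_le)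
  then show ?thesis using qq_le[of k h n lam] k assms by auto
qed

lemma col_lensI: "1 \<le> j \<Longrightarrow> j \<le> lam 1 \<Longrightarrow> col_len n lam j < n \<Longrightarrow> col_len n lam j \<in> col_lens n lam"
  by (auto simp: col_lens_def)

lemma col_lens_pos:
  assumes "1 \<le> n" "q \<in> col_lens n lam" shows "1 \<le> q"
proof -
  obtain j where j: "j \<in> {1..lam 1}" "q = col_len n lam j"
    using assms(2) by (auto simp: col_lens_def)
  then have "1 \<in> {i \<in> {1..n}. j \<le> lam i}" using assms(1) by auto
  then have "{i \<in> {1..n}. j \<le> lam i} \<noteq> {}" by blast
  then show ?thesis unfolding j(2) col_len_def by (simp add: Suc_le_eq card_gt_0_iff)
qed

text \<open>The list is assembled from the left, with \<open>s\<close> descending from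
  \<open>Suc r\<close>. The block added for \<open>s\<close> occupies the positions after
  \<open>lam (q (Suc s))\<close> up to \<open>lam (q s)\<close>, and these are the columns of length
  \<open>q s\<close>.\<close>

lemma key_cols_nth:
  assumes "1 \<le> n" "is_partition n lam" "\<pi> permutes {1..n}" "1 \<le> j" "j \<le> lam 1"
  shows "key_cols n lam \<pi> ! (j - 1) = \<pi> ` {1..col_len n lam j}"
proof -
  define r where "r = num_lens n lam"
  define q where "q = qq n lam"
  \<comment> \<open>\<open>L s\<close> collects the columns of length at least \<open>q s\<close>:
    for \<open>s = Suc r\<close> these are the columns of length \<open>n\<close>, and
    \<open>L 1\<close> is the whole key.\<close>
  define L where "L s = replicate (lam n) {1..n} @
     concat (map (\<lambda>h. replicate (lam (q h) - lam (q (h + 1))) (\<pi> ` {1..q h})) (rev [s..<r + 1]))" for s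
  have q_range: "1 \<le> q s \<and> q s \<le> n" if "1 \<le> s" "s \<le> Suc r" for s
  proof (cases "s = Suc r")
    case True
    then show ?thesis using assms(1) by (simp add: q_def r_def qq_last)
  next
    case False
    then have "q s \<in> col_lens n lam" using that by (simp add: q_def r_def qq_in_col_lens)
    moreover from this have "q s < n" by (simp add: col_lens_def)
    ultimately show ?thesis using col_lens_pos[OF assms(1)] by (simp add: less_imp_le)
  qed
  have L: "length (L s) = lam (q s) \<and> (\<forall>j. 1 \<le> j \<and> j \<le> lam (q s) \<and> j \<le> lam 1 \<longrightarrow>
      L s ! (j - 1) = \<pi> ` {1..col_len n lam j})" if "1 \<le> s" "s \<le> Suc r" for s
    using that(2,1)
  proof (induction s rule: inc_induct)
    case base
    have "col_len n lam j = n" if "j \<le> lam n" for j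
      using le_col_len_iff[of n lam n j] col_len_le[of n lam j] assms that by auto
    then show ?case
      using permutes_image[OF assms(3)]
      by (auto simp: L_def q_def r_def qq_last)
  next
    case (step s)
    have s: "1 \<le> s" "s \<le> r" using step by auto
    have le: "lam (q (Suc s)) \<le> lam (q s)"
      using assms(2) q_range[of s] q_range[of "Suc s"] qq_le[of s "Suc s" n lam] s
      unfolding is_partition_def q_def r_def by (auto simp: monotone_on_def)
    have Ls: "L s = L (Suc s) @ replicate (lam (q s) - lam (q (Suc s))) (\<pi> ` {1..q s})"
    proof -
      have "[s..<r + 1] = s # [Suc s..<r + 1]" using s by (intro upt_conv_Cons) simp
      then show ?thesis by (simp add: L_def del: upt_Suc)
    qed
    have IH: "length (L (Suc s)) = lam (q (Suc s))"
      "\<And>j. 1 \<le> j \<Longrightarrow> j \<le> lam (q (Suc s)) \<Longrightarrow> j \<le> lam 1 \<Longrightarrow>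
        L (Suc s) ! (j - 1) = \<pi> ` {1..col_len n lam j}"
      using step.IH by auto
    have "L s ! (j - 1) = \<pi> ` {1..col_len n lam j}" if j: "1 \<le> j" "j \<le> lam (q s)" "j \<le> lam 1" for j
    proof (cases "j \<le> lam (q (Suc s))")
      case True
      moreover from this have "j - 1 < lam (q (Suc s))" using j by linarith
      ultimately show ?thesis using IH j by (simp add: Ls nth_append)
    next
      case False
      \<comment> \<open>The length is squeezed: it is at least \<open>q s\<close> and below the next
        value \<open>q (Suc s)\<close>, and no column length lies strictly between the two.\<close>
      have ge: "q s \<le> col_len n lam j"
        using le_col_len_iff[OF assms(2), of "q s" j] q_range[of s] s j by auto
      have lt: "col_len n lam j < q (Suc s)"
        using le_col_len_iff[OF assms(2), of "q (Suc s)" j] q_range[of "Suc s"] s False by auto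
      then have "col_len n lam j \<in> col_lens n lam"
        using q_range[of "Suc s"] s j by (intro col_lensI) auto
      then have "col_len n lam j = q s"
        using col_lens_less_qq[of "col_len n lam j" n lam s] s lt ge by (auto simp: q_def r_def)
      then show ?thesis using IH False j by (auto simp: Ls nth_append)
    qed
    then show ?case using le IH by (simp add: Ls)
  qed
  \<comment> \<open>A column beyond \<open>lam (q 1)\<close> would be shorter than
    \<open>q 1\<close>, although every column length less than \<open>n\<close> is some
    \<open>q h\<close> with \<open>h \<ge> 1\<close>. Thus \<open>L 1\<close> reaches all
    columns.\<close>
  have "j \<le> lam (q 1)"
  proof (rule ccontr)
    assume "\<not> j \<le> lam (q 1)"
    then have lt: "col_len n lam j < q 1"
      using le_col_len_iff[OF assms(2), of "q 1" j] q_range[of 1] by auto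
    then have "col_len n lam j \<in> col_lens n lam"
      using q_range[of 1] assms by (intro col_lensI) auto
    then obtain h where "1 \<le> h" "h \<le> r" "col_len n lam j = q h"
      using col_lens_eq_qq unfolding q_def r_def by metis
    with lt qq_le[of 1 h n lam] show False by (auto simp: q_def r_def)
  qed
  moreover have "key_cols n lam \<pi> = L 1"
    by (simp add: key_cols_def L_def q_def r_def)
  ultimately show ?thesis using L[of 1] assms(4,5) by simp
qed

section \<open>Scanning\<close>

text \<open>If the first value is the maximum, only ties can follow it, and each tie is taken. Every
  round of scanning is of this kind while the large values to the right recur in column
  \<open>j\<close>.\<close>

lemma ewis_top:
  assumes "\<forall>y \<in> set (x # xs). f y \<le> f x"
  shows "set (ewis f (x # xs)) = {y \<in> set (x # xs). f y = f x}"
  using assms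
proof (induction xs arbitrary: x rule: length_induct)
  case (1 xs)
  let ?ys = "dropWhile (\<lambda>y. f y < f x) xs"
  have xs: "set xs = set (takeWhile (\<lambda>y. f y < f x) xs) \<union> set ?ys"
    by (metis set_append takeWhile_dropWhile_id)
  have tw: "\<forall>y \<in> set (takeWhile (\<lambda>y. f y < f x) xs). f y < f x"
    by (auto dest: set_takeWhileD)
  show ?case
  proof (cases ?ys)
    case Nil
    then have "\<forall>y \<in> set xs. f y < f x" by (simp add: dropWhile_eq_Nil_conv)
    moreover have "ewis f (x # xs) = [x]"
      by (simp only: ewis.simps(2)[of f x xs] Nil ewis.simps(1))
    ultimately show ?thesis by auto
  next
    case (Cons y ys)
    then have "\<not> f y < f x" by (metis hd_dropWhile list.distinct(1) list.sel(1))
    moreover have sub: "set (y # ys) \<subseteq> set xs"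
      using set_dropWhileD[of _ "\<lambda>y. f y < f x" xs] unfolding Cons by blast
    then have "f y \<le> f x" using 1(2) by simp
    ultimately have y: "f y = f x" by simp
    have "length ys < length xs" using Cons length_dropWhile_le[of "\<lambda>y. f y < f x" xs] by simp
    moreover have "\<forall>u \<in> set (y # ys). f u \<le> f y" using 1(2) sub y by auto
    ultimately have "set (ewis f (y # ys)) = {u \<in> set (y # ys). f u = f y}"
      using 1(1) by blast
    moreover have "{u \<in> set xs. f u = f x} = {u \<in> set (y # ys). f u = f x}"
      using tw unfolding xs Cons by auto
    moreover have "ewis f (x # xs) = x # ewis f (y # ys)"
      by (simp only: ewis.simps(2)[of f x xs] Cons)
    ultimately show ?thesis using y by auto
  qed
qed

lemma ewis_eq_Nil_iff [simp]: "ewis f xs = [] \<longleftrightarrow> xs = []"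
  by (cases xs) auto

lemma last_ewis_ge: "f x \<le> f (last (ewis f (x # xs)))"
proof (induction xs arbitrary: x rule: length_induct)
  case (1 xs)
  show ?case
  proof (cases "dropWhile (\<lambda>y. f y < f x) xs")
    case (Cons y ys)
    then have "f x \<le> f y" by (metis hd_dropWhile list.distinct(1) list.sel(1) not_less)
    moreover have "length ys < length xs"
      using Cons length_dropWhile_le[of "\<lambda>y. f y < f x" xs] by simp
    moreover from this have "f y \<le> f (last (ewis f (y # ys)))" using 1 by blast
    moreover have "ewis f (x # xs) = x # ewis f (y # ys)"
      by (simp only: ewis.simps(2)[of f x xs] Cons)
    ultimately show ?thesis by simp
  qed simp
qed

lemma set_lowest_boxes:
  "set (lowest_boxes m U) = {(k, Max (U `` {k})) |k. 1 \<le> k \<and> k \<le> m \<and> U `` {k} \<noteq> {}}"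
  by (auto simp: lowest_boxes_def)

text \<open>Columns before \<open>j\<close> contribute nothing, so the sequence read in a round
  starts in column \<open>j\<close>.\<close>

lemma lowest_boxes_Cons:
  assumes "1 \<le> j" "j \<le> m" "\<And>b. b \<in> U \<Longrightarrow> j \<le> fst b" "U `` {j} \<noteq> {}"
  shows "lowest_boxes m U = (j, Max (U `` {j})) #
    map (\<lambda>k. (k, Max (U `` {k}))) (filter (\<lambda>k. U `` {k} \<noteq> {}) [Suc j..<m + 1])"
proof -
  have "[1..<m + 1] = [1..<j] @ j # [Suc j..<m + 1]"
    using assms upt_add_eq_append[of 1 j "m + 1 - j"] upt_conv_Cons[of j "m + 1"] by simp
  moreover have "filter (\<lambda>k. U `` {k} \<noteq> {}) [1..<j] = []"
    using assms(3) by (fastforce simp: filter_empty_conv)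
  ultimately show ?thesis using assms(4) by (simp add: lowest_boxes_def)
qed

lemma mem_shape: "(k, i) \<in> shape n lam \<longleftrightarrow> 1 \<le> k \<and> k \<le> lam 1 \<and> 1 \<le> i \<and> i \<le> col_len n lam k"
  by (auto simp: shape_def)

lemma tableau_strict:
  assumes "T \<in> tableaux n lam" "(k, i) \<in> shape n lam" "(k, i') \<in> shape n lam" "i < i'"
  shows "T (k, i) < T (k, i')"
  using assms unfolding tableaux_def by blast

lemma tableau_less_iff:
  assumes "T \<in> tableaux n lam" "(k, i) \<in> shape n lam" "(k, i') \<in> shape n lam"
  shows "T (k, i) < T (k, i') \<longleftrightarrow> i < i'"
  using tableau_strict[OF assms(1), of k i i'] tableau_strict[OF assms(1), of k i' i] assms
  by (cases i i' rule: linorder_cases) auto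

text \<open>As long as the values of the later columns that are at least the entry in question occur in
  column \<open>j\<close>, each round marks exactly the boxes whose value is the current entry of column \<open>j\<close>.\<close>

lemma unmarked_eq:
  assumes T: "T \<in> tableaux n lam" and j: "1 \<le> j" "j \<le> lam 1" and m: "m \<le> col_len n lam j"
    and nested: "\<And>i k i'. col_len n lam j - m < i \<Longrightarrow> i \<le> col_len n lam j \<Longrightarrow>
      (k, i') \<in> shape n lam \<Longrightarrow> j \<le> k \<Longrightarrow> T (j, i) \<le> T (k, i') \<Longrightarrow>
      \<exists>i''. (j, i'') \<in> shape n lam \<and> T (k, i') = T (j, i'')"
  shows "unmarked n lam T j m = {b \<in> shape n lam. j \<le> fst b \<and>
      (\<forall>i. col_len n lam j - m < i \<longrightarrow> i \<le> col_len n lam j \<longrightarrow> T b < T (j, i))} \<and>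
    (\<forall>i. col_len n lam j - m < i \<longrightarrow> i \<le> col_len n lam j \<longrightarrow> scanning n lam T (j, i) = T (j, i))"
  using m nested
proof (induction m)
  case 0
  then show ?case by auto
next
  case (Suc m)
  define z where "z = col_len n lam j"
  \<comment> \<open>After \<open>m\<close> rounds the rows with index above \<open>z - m\<close>
    have been filled, so the current round fills row \<open>i0\<close>; \<open>Suc m \<le> z\<close>
    keeps it at least 1.\<close>
  define i0 where "i0 = z - m"
  have i0: "1 \<le> i0" "i0 \<le> z" "z - Suc m = i0 - 1" "z - i0 = m"
    using Suc.prems(1) by (auto simp: i0_def z_def)
  define U where "U = unmarked n lam T j m"
  have IH: "U = {b \<in> shape n lam. j \<le> fst b \<and> (\<forall>i. i0 < i \<longrightarrow> i \<le> z \<longrightarrow> T b < T (j, i))}"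
    "\<And>i. i0 < i \<Longrightarrow> i \<le> z \<Longrightarrow> scanning n lam T (j, i) = T (j, i)"
  proof -
    have "U = {b \<in> shape n lam. j \<le> fst b \<and> (\<forall>i. i0 < i \<longrightarrow> i \<le> z \<longrightarrow> T b < T (j, i))} \<and>
      (\<forall>i. i0 < i \<longrightarrow> i \<le> z \<longrightarrow> scanning n lam T (j, i) = T (j, i))"
      unfolding U_def i0_def z_def
    proof (rule Suc.IH)
      show "m \<le> col_len n lam j" using Suc.prems(1) by simp
    next
      fix i k i'
      assume "col_len n lam j - m < i" "i \<le> col_len n lam j" "(k, i') \<in> shape n lam" "j \<le> k"
        "T (j, i) \<le> T (k, i')"
      then show "\<exists>i''. (j, i'') \<in> shape n lam \<and> T (k, i') = T (j, i'')"
        by (intro Suc.prems(2)[of i k i']) auto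
    qed
    then show "U = {b \<in> shape n lam. j \<le> fst b \<and> (\<forall>i. i0 < i \<longrightarrow> i \<le> z \<longrightarrow> T b < T (j, i))}"
      "\<And>i. i0 < i \<Longrightarrow> i \<le> z \<Longrightarrow> scanning n lam T (j, i) = T (j, i)"
      by blast+
  qed
  have jsh: "(j, i) \<in> shape n lam \<longleftrightarrow> 1 \<le> i \<and> i \<le> z" for i
    using j by (simp add: mem_shape z_def)
  \<comment> \<open>By nestedness a larger value would be the entry of column \<open>j\<close> in
    some row after \<open>i0\<close>, but \<open>U\<close> holds only values strictly less than
    those entries.\<close>
  have top: "T b \<le> T (j, i0)" if "b \<in> U" for b
  proof (rule ccontr)
    assume neg: "\<not> T b \<le> T (j, i0)"
    obtain k i' where b: "b = (k, i')" by force
    have "\<exists>i''. (j, i'') \<in> shape n lam \<and> T (k, i') = T (j, i'')"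
      using i0 that neg b IH(1) z_def by (intro Suc.prems(2)[of i0]) auto
    then obtain i'' where i'': "(j, i'') \<in> shape n lam" "T b = T (j, i'')"
      using b by auto
    then have "i0 < i''"
      using neg tableau_less_iff[OF T, of j i0 i''] i0 jsh by auto
    then show False using that i'' IH(1) jsh by fastforce
  qed
  have "U `` {j} = {1..i0}"
    using tableau_less_iff[OF T, of j] i0 by (auto simp: IH(1) jsh) (metis le_refl not_le less_le_trans)
  then have Max_j: "Max (U `` {j}) = i0" "U `` {j} \<noteq> {}" using i0 by (auto intro!: Max_eqI)
  obtain bs where bs: "lowest_boxes (lam 1) U = (j, i0) # bs"
    using lowest_boxes_Cons[of j "lam 1" U] Max_j j IH(1) by auto
  have finU: "finite (U `` {k})" for k
    by (rule finite_subset[of _ "{1..col_len n lam k}"]) (auto simp: IH(1) mem_shape)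
  have low: "set (lowest_boxes (lam 1) U) \<subseteq> U"
    using Max_in[OF finU] by (auto simp: set_lowest_boxes)
  have ew: "set (ewis T (lowest_boxes (lam 1) U)) = {b \<in> set (lowest_boxes (lam 1) U). T b = T (j, i0)}"
    unfolding bs by (rule ewis_top) (use top low bs in auto)
  \<comment> \<open>A box of \<open>U\<close> with the maximal value is the lowest unmarked one of
    its column, because columns increase strictly. Hence it is read in this round and
    marked.\<close>
  have marked: "set (ewis T (lowest_boxes (lam 1) U)) = {b \<in> U. T b = T (j, i0)}"
  proof (intro equalityI subsetI)
    fix b assume "b \<in> {b \<in> U. T b = T (j, i0)}"
    then have b: "b \<in> U" "T b = T (j, i0)" by auto
    obtain k i where ki: "b = (k, i)" by force
    have "i' \<le> i" if "i' \<in> U `` {k}" for i'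
    proof -
      have "T (k, i') \<le> T (k, i)" using top that b ki by auto
      moreover have "(k, i') \<in> shape n lam" "(k, i) \<in> shape n lam"
        using that b ki IH(1) by auto
      ultimately show ?thesis using tableau_less_iff[OF T, of k i i'] by auto
    qed
    then have "Max (U `` {k}) = i" using b ki finU by (intro Max_eqI) auto
    moreover have "1 \<le> k" "k \<le> lam 1" using b ki IH(1) by (auto simp: mem_shape)
    ultimately have "b \<in> set (lowest_boxes (lam 1) U)"
      using b ki by (auto simp: set_lowest_boxes)
    then show "b \<in> set (ewis T (lowest_boxes (lam 1) U))" using b ew by auto
  qed (use ew low in auto)
  have upd: "unmarked n lam T j (Suc m) = U - {b \<in> U. T b = T (j, i0)}"
    using marked by (simp add: U_def)
  have less_i: "T (j, i0) < T (j, i)" if "i0 < i" "i \<le> z" for i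
    using tableau_less_iff[OF T, of j i0 i] that i0 jsh by auto
  have unm: "unmarked n lam T j (Suc m) =
      {b \<in> shape n lam. j \<le> fst b \<and> (\<forall>i. i0 - 1 < i \<longrightarrow> i \<le> z \<longrightarrow> T b < T (j, i))}" (is "_ = ?R")
  proof (intro equalityI subsetI)
    fix b assume "b \<in> unmarked n lam T j (Suc m)"
    then have b: "b \<in> U" "T b \<noteq> T (j, i0)" using upd by auto
    then have "T b < T (j, i0)" using top[of b] by simp
    note b = b(1) this
    have "T b < T (j, i)" if "i0 - 1 < i" "i \<le> z" for i
    proof -
      have "i = i0 \<or> i0 < i" using that(1) by linarith
      then show ?thesis using less_i[of i] b that(2) by auto
    qed
    with b show "b \<in> ?R" using IH(1) by auto
  next
    fix b assume "b \<in> ?R"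
    then show "b \<in> unmarked n lam T j (Suc m)" using upd IH(1) i0 by fastforce
  qed
  have scan_i0: "scanning n lam T (j, i0) = T (j, i0)"
  proof -
    have "last (ewis T (lowest_boxes (lam 1) U)) \<in> set (ewis T (lowest_boxes (lam 1) U))"
      unfolding bs by (intro last_in_set) simp
    then have "T (last (ewis T (lowest_boxes (lam 1) U))) = T (j, i0)" using marked by auto
    moreover have "(j, i0) \<in> shape n lam" using i0 jsh by auto
    ultimately show ?thesis using i0 by (simp add: scanning_def U_def z_def)
  qed
  have "scanning n lam T (j, i) = T (j, i)" if "i0 - 1 < i" "i \<le> z" for i
  proof -
    have "i = i0 \<or> i0 < i" using that(1) by linarith
    then show ?thesis using IH(2)[of i] scan_i0 that(2) by auto
  qed
  then show ?case unfolding z_def[symmetric] i0(3) using unm by blast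
qed

text \<open>The box read in column \<open>j\<close> has value at most that of
  \<open>(Suc j, s)\<close>. The box read in column \<open>Suc j\<close> is
  \<open>(Suc j, s)\<close> or lies lower, so its value is no smaller. It is therefore the second
  member of the EWIS and bounds the last value from below.\<close>

lemma scanning_ge:
  assumes "(j, i) \<in> shape n lam" "j < lam 1"
    and U: "U = unmarked n lam T j (col_len n lam j - i)" "U \<subseteq> shape n lam" "\<And>b. b \<in> U \<Longrightarrow> j \<le> fst b"
    and T: "T \<in> tableaux n lam"
    and first: "U `` {j} \<noteq> {}" "\<And>i'. (j, i') \<in> U \<Longrightarrow> T (j, i') \<le> T (Suc j, s)"
    and second: "(Suc j, s) \<in> U"
  shows "T (Suc j, s) \<le> scanning n lam T (j, i)"
proof -
  have fin: "finite (U `` {k})" for k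
    by (rule finite_subset[of _ "{1..col_len n lam k}"]) (use U(2) in \<open>auto simp: mem_shape\<close>)
  define t where "t = Max (U `` {j})"
  define s' where "s' = Max (U `` {Suc j})"
  have "t \<in> U `` {j}" unfolding t_def using fin first(1) by (rule Max_in)
  then have t: "T (j, t) \<le> T (Suc j, s)" using first(2) by auto
  have s'U: "s' \<in> U `` {Suc j}" unfolding s'_def by (rule Max_in[OF fin]) (use second in auto)
  moreover have "s \<le> s'" unfolding s'_def by (rule Max_ge[OF fin]) (use second in auto)
  ultimately have s': "T (Suc j, s) \<le> T (Suc j, s')"
    using tableau_less_iff[OF T, of "Suc j" s' s] second U(2) by (auto simp flip: not_less)
  have "[Suc j..<lam 1 + 1] = Suc j # [Suc (Suc j)..<lam 1 + 1]"
    using assms(2) by (intro upt_conv_Cons) simp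
  moreover have "U `` {Suc j} \<noteq> {}" using second by auto
  moreover have "lowest_boxes (lam 1) U = (j, t) #
      map (\<lambda>k. (k, Max (U `` {k}))) (filter (\<lambda>k. U `` {k} \<noteq> {}) [Suc j..<lam 1 + 1])"
    unfolding t_def using U(3) first(1) assms(1)
    by (intro lowest_boxes_Cons) (auto simp: mem_shape)
  ultimately obtain bs where bs: "lowest_boxes (lam 1) U = (j, t) # (Suc j, s') # bs"
    by (simp add: s'_def del: upt_Suc)
  have "ewis T (lowest_boxes (lam 1) U) = (j, t) # ewis T ((Suc j, s') # bs)"
    unfolding bs using t s' by simp
  then have "T (last (ewis T (lowest_boxes (lam 1) U))) \<ge> T (Suc j, s')"
    using last_ewis_ge[of T "(Suc j, s')" bs] by simp
  then show ?thesis using s' assms(1) by (simp add: scanning_def U(1))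
qed

section \<open>Tableaux given by lists of columns\<close>

text \<open>Columns are lists so that truncating them and replacing one entry stay elementary. Rows
  are counted from 1 and list positions from 0.\<close>

definition col_tab :: "nat \<Rightarrow> (nat \<Rightarrow> nat) \<Rightarrow> (nat \<Rightarrow> nat list) \<Rightarrow> nat \<times> nat \<Rightarrow> int" where
  "col_tab n lam L = (\<lambda>(k, i) \<in> shape n lam. int (L k ! (i - 1)))"

definition col_family :: "nat \<Rightarrow> (nat \<Rightarrow> nat) \<Rightarrow> (nat \<Rightarrow> nat list) \<Rightarrow> bool" where
  "col_family n lam L \<longleftrightarrow>
     (\<forall>k \<in> {1..lam 1}. length (L k) = col_len n lam k \<and> sorted_wrt (<) (L k) \<and> set (L k) \<subseteq> {1..n})"

lemma col_tab_apply: "(k, i) \<in> shape n lam \<Longrightarrow> col_tab n lam L (k, i) = int (L k ! (i - 1))"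
  by (simp add: col_tab_def)

lemma col_tab_tableau:
  assumes "col_family n lam L"
    and rows: "\<And>k k' i. 1 \<le> k \<Longrightarrow> k < k' \<Longrightarrow> k' \<le> lam 1 \<Longrightarrow> i < col_len n lam k' \<Longrightarrow> L k ! i \<le> L k' ! i"
  shows "col_tab n lam L \<in> tableaux n lam"
proof -
  have fam: "length (L k) = col_len n lam k" "sorted_wrt (<) (L k)" "set (L k) \<subseteq> {1..n}"
    if "1 \<le> k" "k \<le> lam 1" for k
    using assms(1) that by (auto simp: col_family_def)
  have "int (L k ! (i - 1)) \<in> {1..int n}" if "(k, i) \<in> shape n lam" for k i
  proof -
    have "L k ! (i - 1) \<in> set (L k)"
      using that fam(1)[of k] by (intro nth_mem) (auto simp: mem_shape)
    then show ?thesis using fam(3)[of k] that by (auto simp: mem_shape)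
  qed
  then have "col_tab n lam L \<in> shape n lam \<rightarrow>\<^sub>E {1..int n}"
    by (auto simp: col_tab_def restrict_def)
  moreover have "col_tab n lam L (k, i) < col_tab n lam L (k, i')"
    if "(k, i) \<in> shape n lam" "(k, i') \<in> shape n lam" "i < i'" for k i i'
    using that fam(1)[of k] sorted_wrt_nth_less[OF fam(2)[of k], of "i - 1" "i' - 1"]
    by (auto simp: col_tab_apply mem_shape)
  moreover have "col_tab n lam L (k, i) \<le> col_tab n lam L (k', i)"
    if "(k, i) \<in> shape n lam" "(k', i) \<in> shape n lam" "k < k'" for k k' i
    using that rows[of k k' "i - 1"] by (auto simp: col_tab_apply mem_shape)
  ultimately show ?thesis unfolding tableaux_def by blast
qed

text \<open>Such tableaux are keys, and a key is its own scanning tableau: each value to the right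
  of column \<open>j\<close> recurs in column \<open>j\<close>, so \<open>unmarked_eq\<close>
  applies to all rounds. Membership in a Demazure set then reduces to comparison with the
  key.\<close>

lemma col_tab_nested:
  assumes fam: "col_family n lam L"
    and nested: "\<And>k k'. 1 \<le> k \<Longrightarrow> k < k' \<Longrightarrow> k' \<le> lam 1 \<Longrightarrow> set (L k') \<subseteq> set (L k)"
  shows "col_tab n lam L \<in> tableaux n lam" and "scanning n lam (col_tab n lam L) = col_tab n lam L"
proof -
  let ?T = "col_tab n lam L"
  show T: "?T \<in> tableaux n lam"
  proof (rule col_tab_tableau[OF fam])
    fix k k' i assume k: "1 \<le> k" "k < k'" "k' \<le> lam 1" "i < col_len n lam k'"
    then show "L k ! i \<le> L k' ! i"
      using fam nested[of k k'] by (intro strict_sorted_nth_subset) (auto simp: col_family_def)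
  qed
  have "scanning n lam ?T (j, i) = ?T (j, i)" if ji: "(j, i) \<in> shape n lam" for j i
  proof -
    have j: "1 \<le> j" "j \<le> lam 1" "1 \<le> i" "i \<le> col_len n lam j"
      using ji by (auto simp: mem_shape)
    have "\<exists>i''. (j, i'') \<in> shape n lam \<and> ?T (k, i') = ?T (j, i'')"
      if k: "(k, i') \<in> shape n lam" "j \<le> k" for k i'
    proof -
      have "L k ! (i' - 1) \<in> set (L k)"
        using k fam by (intro nth_mem) (auto simp: mem_shape col_family_def)
      then have "L k ! (i' - 1) \<in> set (L j)"
        using nested[of j k] k j by (cases "j = k") (auto simp: mem_shape)
      then obtain u where "u < length (L j)" "L j ! u = L k ! (i' - 1)"
        by (auto simp: in_set_conv_nth)
      then have "(j, Suc u) \<in> shape n lam \<and> ?T (k, i') = ?T (j, Suc u)"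
        using k j fam by (auto simp: col_tab_def mem_shape col_family_def)
      then show ?thesis by blast
    qed
    then show ?thesis
      using unmarked_eq[OF T j(1,2), of "col_len n lam j"] j by auto
  qed
  then show "scanning n lam ?T = ?T"
    by (auto simp: scanning_def col_tab_def restrict_def)
qed

definition key_col :: "nat \<Rightarrow> (nat \<Rightarrow> nat) \<Rightarrow> (nat \<Rightarrow> nat) \<Rightarrow> nat \<Rightarrow> nat list" where
  "key_col n lam \<pi> k = sorted_list_of_set (\<pi> ` {1..col_len n lam k})"

lemma set_key_col: "set (key_col n lam \<pi> k) = \<pi> ` {1..col_len n lam k}"
  by (simp add: key_col_def)

lemma col_family_key_col:
  assumes "\<pi> permutes {1..n}"
  shows "col_family n lam (key_col n lam \<pi>)"
proof -
  have "card (\<pi> ` {1..m}) = m" for m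
    using permutes_inj_on[OF assms] by (simp add: card_image)
  moreover have "\<pi> ` {1..col_len n lam k} \<subseteq> {1..n}" for k
    using permutes_image[OF assms] col_len_le[of n lam k] image_mono[of "{1..col_len n lam k}" "{1..n}" \<pi>]
    by auto
  ultimately show ?thesis by (simp add: col_family_def key_col_def)
qed

lemma key_col_subset: "k \<le> k' \<Longrightarrow> set (key_col n lam \<pi> k') \<subseteq> set (key_col n lam \<pi> k)"
  using col_len_antimono[of k k' n lam] by (auto simp: set_key_col)

lemma lam_key_eq:
  assumes "1 \<le> n" "is_partition n lam" "\<pi> permutes {1..n}"
  shows "lam_key n lam \<pi> = col_tab n lam (key_col n lam \<pi>)"
  using key_cols_nth[OF assms]
  by (auto simp: lam_key_def col_tab_def key_col_def mem_shape restrict_def fun_eq_iff)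

text \<open>A linear inequality that holds at both ends of a segment holds along it, so a polytope
  contains every lattice point of the segment.\<close>

lemma convex_polytope_segment:
  assumes "convex_polytope I D" "x \<in> D" "y \<in> D" "z \<in> I \<rightarrow>\<^sub>E UNIV" "0 \<le> s" "s \<le> 1"
    and "\<And>b. b \<in> I \<Longrightarrow> real_of_int (z b) = s * real_of_int (x b) + (1 - s) * real_of_int (y b)"
  shows "z \<in> D"
proof -
  obtain F :: "(('a \<Rightarrow> real) \<times> real) set" where
    D: "D = {x \<in> I \<rightarrow>\<^sub>E UNIV. \<forall>(a, c) \<in> F. (\<Sum>b\<in>I. a b * real_of_int (x b)) \<le> c}"
    using assms(1) unfolding convex_polytope_def by blast
  have "(\<Sum>b\<in>I. a b * real_of_int (z b)) \<le> c" if "(a, c) \<in> F" for a c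
  proof -
    have "(\<Sum>b\<in>I. a b * real_of_int (z b)) =
        s * (\<Sum>b\<in>I. a b * real_of_int (x b)) + (1 - s) * (\<Sum>b\<in>I. a b * real_of_int (y b))"
      unfolding sum_distrib_left sum.distrib[symmetric]
      by (intro sum.cong) (auto simp: assms(7) algebra_simps)
    also have "\<dots> \<le> c"
      by (rule convex_bound_le) (use that assms D in auto)
    finally show ?thesis .
  qed
  then show ?thesis using assms(4) D by auto
qed

section \<open>The three tableaux\<close>

text \<open>\<open>T1\<close>, \<open>T2\<close>, \<open>T3\<close> are the tableaux
  \<open>T x'\<close>, \<open>T y\<close>, \<open>T z'\<close> built below. The witness
  \<open>T2\<close> refutes equality with the ideal and convexity at once.\<close>

lemma nonconvex_witness:
  assumes n: "1 \<le> n" and part: "is_partition n lam" and perm: "\<pi> permutes {1..n}"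
    and j: "1 \<le> j" "j < lam 1" and p: "p = col_len n lam (Suc j)" and q: "q = col_len n lam j"
    and abc: "1 \<le> a" "a \<le> p" "p < b" "b \<le> q" "q < c" "c \<le> n" "\<pi> b < \<pi> c" "\<pi> c < \<pi> a"
  obtains T1 T2 T3 s where "T1 \<in> demazure_tableaux n lam \<pi>" "T3 \<in> demazure_tableaux n lam \<pi>"
    "T2 \<in> principal_ideal n lam (lam_key n lam \<pi>)" "T2 \<notin> demazure_tableaux n lam \<pi>"
    "0 \<le> s" "s \<le> 1"
    "\<And>b. b \<in> shape n lam \<Longrightarrow> real_of_int (T2 b) = s * real_of_int (T1 b) + (1 - s) * real_of_int (T3 b)"
proof -

  \<comment> \<open>The entry sets of the two columns and the lowering of the right one\<close>
  define K where "K = key_col n lam \<pi>"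
  define A where "A = \<pi> ` {1..p}"
  define B where "B = \<pi> ` {1..q}"
  define y where "y = \<pi> c"
  have inj: "inj \<pi>" using perm by (rule permutes_inj)
  have fin: "finite A" "finite B" by (simp_all add: A_def B_def)
  have AB: "A \<subseteq> B" using abc by (auto simp: A_def B_def)
  have cardA: "card A = p" unfolding A_def
    using inj_on_subset[OF inj] by (simp add: card_image)
  have Bn: "B \<subseteq> {1..n}"
  proof -
    have "B \<subseteq> \<pi> ` {1..n}"
      unfolding B_def q using col_len_le[of n lam j] by (intro image_mono) auto
    then show ?thesis unfolding permutes_image[OF perm] .
  qed
  \<comment> \<open>In the pattern \<open>x\<close>, \<open>y\<close>, \<open>z\<close>, the outer
    values are \<open>\<pi> b\<close> and \<open>\<pi> a\<close>; \<open>y = \<pi> c\<close> is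
    absent from \<open>B\<close> since \<open>c > q\<close>.\<close>
  have x: "\<pi> b \<in> B" "\<pi> b \<notin> A" "\<pi> b < y" and z: "\<pi> a \<in> A" "y < \<pi> a" and yB: "y \<notin> B"
    using abc by (auto simp: A_def B_def y_def inj_image_mem_iff[OF inj])
  define x' where "x' = Max {v \<in> B. v < y}"
  define z' where "z' = Min {v \<in> B. y < v}"
  have x': "x' \<in> B" "x' < y" "\<And>v. v \<in> B \<Longrightarrow> v < y \<Longrightarrow> v \<le> x'"
  proof -
    have "x' \<in> {v \<in> B. v < y}" unfolding x'_def using fin x by (intro Max_in) auto
    then show "x' \<in> B" "x' < y" by auto
    show "v \<le> x'" if "v \<in> B" "v < y" for v
      unfolding x'_def using fin that by (intro Max_ge) auto
  qed
  have z': "z' \<in> B" "y < z'" "\<And>v. v \<in> B \<Longrightarrow> y < v \<Longrightarrow> z' \<le> v"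
  proof -
    have "z' \<in> {v \<in> B. y < v}" unfolding z'_def using fin z AB by (intro Min_in) auto
    then show "z' \<in> B" "y < z'" by auto
    show "z' \<le> v" if "v \<in> B" "y < v" for v
      unfolding z'_def using fin that by (intro Min_le) auto
  qed
  \<comment> \<open>Lower \<open>A\<close> by exchanges until it avoids \<open>x'\<close> and contains \<open>z'\<close>.\<close>
  define A1 where "A1 = (if x' \<in> A then insert (\<pi> b) (A - {x'}) else A)"
  have xx': "\<pi> b \<le> x'" using x x' by auto
  have A1: "A1 \<subseteq> B" "x' \<notin> A1" "\<pi> a \<in> A1" "card A1 = p"
    "\<And>i. i < p \<Longrightarrow> sorted_list_of_set A1 ! i \<le> sorted_list_of_set A ! i"
  proof -
    show "A1 \<subseteq> B" "x' \<notin> A1" "\<pi> a \<in> A1"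
      using AB x z x' by (auto simp: A1_def)
    show "card A1 = p"
      using x fin cardA card_Suc_Diff1[of A x'] by (auto simp: A1_def)
    show "sorted_list_of_set A1 ! i \<le> sorted_list_of_set A ! i" if "i < p" for i
    proof (cases "x' \<in> A")
      case True
      with x xx' have "\<pi> b < x'" by (metis le_neq_implies_less)
      with True x fin that cardA sorted_list_of_set_nth_exchange[of A x' "\<pi> b" i] show ?thesis
        by (simp add: A1_def)
    qed (simp add: A1_def)
  qed
  have finA1: "finite A1" using A1(1) fin finite_subset by blast
  \<comment> \<open>\<open>\<pi> a\<close> survives the first exchange because it exceeds
    \<open>y\<close> and so differs from \<open>x'\<close>. It can be traded for \<open>z'\<close>,
    which is at most \<open>\<pi> a\<close>.\<close>
  define A2 where "A2 = (if z' \<in> A1 then A1 else insert z' (A1 - {\<pi> a}))"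
  have zz': "z' \<le> \<pi> a" using z z' AB by auto
  have A2: "A2 \<subseteq> B" "x' \<notin> A2" "z' \<in> A2" "card A2 = p"
    "\<And>i. i < p \<Longrightarrow> sorted_list_of_set A2 ! i \<le> sorted_list_of_set A ! i"
  proof -
    show "A2 \<subseteq> B" "x' \<notin> A2" "z' \<in> A2"
      using A1 x' z' by (auto simp: A2_def)
    show "card A2 = p"
      using A1 finA1 card_Suc_Diff1[of A1 "\<pi> a"] by (auto simp: A2_def)
    show "sorted_list_of_set A2 ! i \<le> sorted_list_of_set A ! i" if "i < p" for i
    proof (cases "z' \<in> A1")
      case False
      with A1 zz' have "z' < \<pi> a" by (metis le_neq_implies_less)
      with False A1 finA1 that sorted_list_of_set_nth_exchange[of A1 "\<pi> a" z' i]
      have "sorted_list_of_set A2 ! i \<le> sorted_list_of_set A1 ! i"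
        by (simp add: A2_def)
      with A1(5)[OF that] show ?thesis by simp
    qed (use A1(5)[OF that] in \<open>simp add: A2_def\<close>)
  qed

  \<comment> \<open>Columns depending on the value \<open>w\<close>\<close>
  define Q where "Q = A2 - {z'}"
  have Q: "Q \<subseteq> B" "x' \<notin> Q" "z' \<notin> Q" "finite Q" "insert z' Q = A2" "y \<notin> Q"
    using A2 fin yB finite_subset[OF A2(1)] by (auto simp: Q_def)
  define xs where "xs = sorted_list_of_set {v \<in> Q. v < y}"
  define ys where "ys = sorted_list_of_set {v \<in> Q. y < v}"
  define W where "W w = xs @ w # ys" for w
  have set_xs: "set xs = {v \<in> Q. v < y}" and set_ys: "set ys = {v \<in> Q. y < v}"
    using Q(4) by (auto simp: xs_def ys_def)
  have below: "v < x'" if "v \<in> set xs" for v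
    using that x'(3)[of v] Q set_xs by (metis (mono_tags, lifting) mem_Collect_eq le_neq_implies_less subsetD)
  have above: "z' < v" if "v \<in> set ys" for v
    using that z'(3)[of v] Q set_ys by (metis (mono_tags, lifting) mem_Collect_eq le_neq_implies_less subsetD)
  \<comment> \<open>No element of \<open>Q\<close> lies between \<open>x'\<close> and \<open>z'\<close>, so all three values \<open>w\<close> take the same place.\<close>
  have W_sorted: "sorted_wrt (<) (W w)" if "x' \<le> w" "w \<le> z'" for w
  proof -
    have "sorted_wrt (<) xs" "sorted_wrt (<) ys" by (simp_all add: xs_def ys_def)
    then show ?thesis
      using that below above x' z' unfolding W_def sorted_wrt_append by fastforce
  qed
  have set_W: "set (W w) = insert w Q" for w
    using Q(6) by (auto simp: W_def set_xs set_ys) (metis linorder_neqE_nat)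
  have W_z': "W z' = sorted_list_of_set A2"
    using sorted_list_of_set_strict_eq[OF W_sorted[of z']] x' z' set_W[of z'] Q(5) by simp
  have len_W: "length (W w) = p" for w
  proof -
    have "length (W w) = length (W z')" by (simp add: W_def)
    then show ?thesis using W_z' A2(4) by simp
  qed
  have W_mono: "W w ! i \<le> W w' ! i" if "w \<le> w'" for w w' i
    using that by (cases "i < length xs") (auto simp: W_def nth_append nth_Cons')
  define L where "L w k = (if k \<le> j then K k else take (col_len n lam k) (W w))" for w k
  have Kj: "set (K j) = B" "length (K j) = q" "sorted_wrt (<) (K j)"
    using col_family_key_col[OF perm, of lam] j
    by (auto simp: K_def set_key_col B_def q col_family_def)
  have len_right: "col_len n lam k \<le> p" if "j < k" for k
    using that col_len_antimono[of "Suc j" k n lam] p by simp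
  have L_right: "L w k ! i = W w ! i" if "j < k" "i < col_len n lam k" for w k i
    using that by (simp add: L_def)
  have fam: "col_family n lam (L w)" if "x' \<le> w" "w \<le> z'" for w
    unfolding col_family_def
  proof
    fix k assume k: "k \<in> {1..lam 1}"
    show "length (L w k) = col_len n lam k \<and> sorted_wrt (<) (L w k) \<and> set (L w k) \<subseteq> {1..n}"
    proof (cases "k \<le> j")
      case True
      then show ?thesis
        using col_family_key_col[OF perm, of lam] k by (simp add: L_def K_def col_family_def)
    next
      case False
      have "w \<in> {1..n}" using that x'(1) z'(1) Bn by auto
      then have "set (W w) \<subseteq> {1..n}" using set_W[of w] Q(1) Bn by auto
      then show ?thesis
        using False len_right[of k] len_W[of w] W_sorted[OF that]
        by (auto simp: L_def sorted_wrt_take dest: in_set_takeD)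
    qed
  qed
  \<comment> \<open>Columns beyond \<open>j\<close> are initial segments of one list and hence
    nested for every \<open>w\<close>. The condition \<open>w \<in> B\<close> matters only in
    passing from column \<open>j\<close> to later ones; it holds for \<open>x'\<close> and
    \<open>z'\<close> and fails for \<open>y\<close>.\<close>
  have nested: "set (L w k') \<subseteq> set (L w k)" if "w \<in> B" "1 \<le> k" "k < k'" "k' \<le> lam 1" for w k k'
  proof (cases "k' \<le> j")
    case True
    then show ?thesis using that key_col_subset[of k k'] by (simp add: L_def K_def)
  next
    case k': False
    show ?thesis
    proof (cases "k \<le> j")
      case True
      have "set (L w k') \<subseteq> insert w Q"
        using k' set_W[of w] by (auto simp: L_def dest: in_set_takeD)
      also have "\<dots> \<subseteq> set (K j)" using Kj Q(1) that by auto
      also have "\<dots> \<subseteq> set (K k)" using True key_col_subset[of k j] by (simp add: K_def)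
      finally show ?thesis using True by (simp add: L_def)
    next
      case False
      then show ?thesis
        using k' that col_len_antimono[of k k' n lam] by (simp add: L_def set_take_subset_set_take)
    qed
  qed

  \<comment> \<open>The tableaux and their comparison with the key\<close>
  define T where "T w = col_tab n lam (L w)" for w
  have key: "lam_key n lam \<pi> = col_tab n lam K"
    unfolding K_def using lam_key_eq[OF n part perm] .
  have T_mono: "tab_le n lam (T w) (T w')" if "w \<le> w'" for w w'
    using W_mono[OF that] by (auto simp: tab_le_def T_def col_tab_apply L_def mem_shape)
  \<comment> \<open>By \<open>T_mono\<close> the largest value \<open>w = z'\<close> suffices.
    Beyond column \<open>j\<close> the entries of \<open>A2\<close> are at most those of
    \<open>A\<close>, which are at most those of the key because later key columns are subsets of
    \<open>A\<close>.\<close>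
  have T_le: "tab_le n lam (T z') (lam_key n lam \<pi>)"
    unfolding tab_le_def
  proof
    fix b' assume b': "b' \<in> shape n lam"
    obtain k i where ki: "b' = (k, i)" by force
    have "L z' k ! (i - 1) \<le> K k ! (i - 1)"
    proof (cases "k \<le> j")
      case False
      have i: "i - 1 < col_len n lam k" using b' ki by (auto simp: mem_shape)
      have "L z' k ! (i - 1) = sorted_list_of_set A2 ! (i - 1)"
        using False i L_right W_z' by simp
      also have "\<dots> \<le> sorted_list_of_set A ! (i - 1)"
        using A2(5) i len_right[of k] False by simp
      also have "\<dots> \<le> K k ! (i - 1)"
        unfolding K_def key_col_def
      proof (rule sorted_list_of_set_nth_subset[OF fin(1)])
        show "\<pi> ` {1..col_len n lam k} \<subseteq> A" using len_right[of k] False by (auto simp: A_def)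
        show "i - 1 < card (\<pi> ` {1..col_len n lam k})"
          using i inj_on_subset[OF inj] by (simp add: card_image)
      qed
      finally show ?thesis .
    qed (simp add: L_def)
    then show "T z' b' \<le> lam_key n lam \<pi> b'"
      using b' by (simp add: ki key T_def col_tab_apply)
  qed
  have T_key: "tab_le n lam (T w) (lam_key n lam \<pi>)" if "w \<le> z'" for w
    using T_mono[OF that] T_le by (force simp: tab_le_def)
  have dem: "T w \<in> demazure_tableaux n lam \<pi>" if "w \<in> B" "x' \<le> w" "w \<le> z'" for w
    using col_tab_nested[OF fam[OF that(2,3)] nested[OF that(1)]] T_key[OF that(3)]
    by (simp add: demazure_tableaux_def T_def)
  have T2: "T y \<in> tableaux n lam"
    unfolding T_def
  proof (rule col_tab_tableau)
    show "col_family n lam (L y)" using fam x' z' by simp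
    fix k k' i assume k: "1 \<le> k" "k < k'" "k' \<le> lam 1" "i < col_len n lam k'"
    \<comment> \<open>The columns of \<open>T y\<close> are not nested, so its rows are checked
      through \<open>T x'\<close>: both agree up to column \<open>j\<close>, and \<open>T y\<close>
      is at least as large afterwards.\<close>
    have fx: "col_family n lam (L x')" using fam x' z' by simp
    have x'_le: "L x' k ! i \<le> L x' k' ! i"
      using fx nested[OF x'(1), of k k'] k
      by (intro strict_sorted_nth_subset) (auto simp: col_family_def)
    have W_le: "W x' ! i \<le> W y ! i" using W_mono x' by simp
    show "L y k ! i \<le> L y k' ! i"
    proof (cases "k \<le> j")
      case True
      then have "L y k ! i = L x' k ! i" by (simp add: L_def)
      moreover have "L x' k' ! i \<le> L y k' ! i"
        using k W_le L_right[of k' i] by (cases "k' \<le> j") (auto simp: L_def)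
      ultimately show ?thesis using x'_le by simp
    next
      case False
      then show ?thesis using k col_len_antimono[of k k' n lam] by (simp add: L_right)
    qed
  qed

  \<comment> \<open>Scanning the middle tableau\<close>
  have "\<not> tab_le n lam (scanning n lam (T y)) (lam_key n lam \<pi>)"
  proof
    assume le: "tab_le n lam (scanning n lam (T y)) (lam_key n lam \<pi>)"
    \<comment> \<open>Row \<open>Suc u\<close> of column \<open>j\<close> holds \<open>x'\<close> in
      the key and in \<open>T y\<close>; the scanning tableau will exceed the key there.\<close>
    obtain u where u: "u < q" "K j ! u = x'"
      using x'(1) Kj by (metis in_set_conv_nth)
    have jsh: "(j, i) \<in> shape n lam \<longleftrightarrow> 1 \<le> i \<and> i \<le> q" for i
      using j by (simp add: mem_shape q)
    have Tj: "T y (j, i) = int (K j ! (i - 1))" if "1 \<le> i" "i \<le> q" for i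
      using that jsh by (simp add: T_def col_tab_apply L_def)
    have bigger: "z' \<le> K j ! (i - 1)" if "Suc u < i" "i \<le> q" for i
    proof -
      have "x' < K j ! (i - 1)"
        using sorted_wrt_nth_less[OF Kj(3), of u "i - 1"] u that Kj(2) by auto
      moreover have KB: "K j ! (i - 1) \<in> B"
        using nth_mem[of "i - 1" "K j"] that Kj(1,2) by simp
      ultimately have "\<not> K j ! (i - 1) < y" using x'(3) by fastforce
      moreover have "K j ! (i - 1) \<noteq> y" using KB yB by metis
      ultimately show ?thesis using z'(3)[OF KB] by simp
    qed
    define U where "U = unmarked n lam (T y) j (q - Suc u)"
    have qu: "q - (q - Suc u) = Suc u" using u by simp
    \<comment> \<open>The rounds before row \<open>Suc u\<close> have thresholds at least
      \<open>z'\<close>. An entry of \<open>W y\<close> that large is not \<open>y\<close>, so it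
      lies in \<open>Q\<close> and hence in \<open>B\<close>. These rounds thus run as for nested
      columns, and \<open>y\<close> stays unmarked.\<close>
    have U: "U = {b \<in> shape n lam. j \<le> fst b \<and> (\<forall>i. Suc u < i \<longrightarrow> i \<le> q \<longrightarrow> T y b < T y (j, i))}"
    proof -
      have "\<exists>i''. (j, i'') \<in> shape n lam \<and> T y (k, i') = T y (j, i'')"
        if i: "Suc u < i" "i \<le> q" "(k, i') \<in> shape n lam" "j \<le> k" "T y (j, i) \<le> T y (k, i')" for i k i'
      proof (cases "k = j")
        case False
        then have k: "j < k" using i by simp
        have Ty: "T y (k, i') = int (W y ! (i' - 1))"
          using i k by (auto simp: T_def col_tab_apply L_right mem_shape)
        have "W y ! (i' - 1) \<in> set (W y)"
          using i k len_right[of k] len_W[of y] by (intro nth_mem) (auto simp: mem_shape)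
        moreover have "z' \<le> W y ! (i' - 1)"
          using bigger[OF i(1,2)] i Ty Tj[of i] by simp
        ultimately have "W y ! (i' - 1) \<in> set (K j)"
          using set_W[of y] z'(2) Q(1) Kj(1) by auto
        then obtain v where "v < q" "K j ! v = W y ! (i' - 1)"
          using Kj(2) by (metis in_set_conv_nth)
        then show ?thesis using Ty Tj[of "Suc v"] jsh[of "Suc v"] by (intro exI[of _ "Suc v"]) auto
      qed (use i in auto)
      then show ?thesis
        using unmarked_eq[OF T2 j(1), of "q - Suc u"] j qu unfolding U_def q by auto
    qed
    \<comment> \<open>The row of \<open>y\<close> in column \<open>Suc j\<close>; that column has
      length \<open>p\<close>, so \<open>W y\<close> appears in it without truncation.\<close>
    define s where "s = Suc (length xs)"
    have ssh: "(Suc j, s) \<in> shape n lam" "T y (Suc j, s) = int y"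
    proof -
      have "s \<le> p" using len_W[of y] by (simp add: s_def W_def)
      then show sh: "(Suc j, s) \<in> shape n lam" using j by (simp add: mem_shape p s_def)
      then show "T y (Suc j, s) = int y"
        using L_right[of "Suc j" "length xs" y] by (simp add: T_def col_tab_apply mem_shape s_def W_def)
    qed
    have "(Suc j, s) \<in> U"
      using ssh bigger z'(2) Tj unfolding U by force
    moreover have "T y (j, i') \<le> T y (Suc j, s)" if "(j, i') \<in> U" for i'
    proof -
      have "(j, i') \<in> shape n lam" using that U by auto
      then have i': "1 \<le> i'" "i' \<le> q" using jsh by auto
      have "i' \<le> Suc u" using that i' unfolding U by (auto simp: not_less[symmetric])
      then have "T y (j, i') \<le> T y (j, Suc u)"
        using tableau_less_iff[OF T2, of j "Suc u" i'] i' u jsh by (simp add: not_less[symmetric])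
      then show ?thesis using ssh Tj[of "Suc u"] u x'(2) by simp
    qed
    moreover have "(j, Suc u) \<in> U"
      using jsh u tableau_less_iff[OF T2, of j "Suc u"] unfolding U by auto
    then have "U `` {j} \<noteq> {}" by blast
    moreover have "(j, Suc u) \<in> shape n lam" using jsh u by simp
    moreover have "U \<subseteq> shape n lam" "\<And>b. b \<in> U \<Longrightarrow> j \<le> fst b" unfolding U by auto
    moreover have "U = unmarked n lam (T y) j (col_len n lam j - Suc u)" by (simp add: U_def q)
    ultimately have "T y (Suc j, s) \<le> scanning n lam (T y) (j, Suc u)"
      using scanning_ge[of j "Suc u" n lam U "T y" s] j(2) T2 by blast
    also have "\<dots> \<le> lam_key n lam \<pi> (j, Suc u)"
      using le jsh[of "Suc u"] u by (auto simp: tab_le_def)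
    also have "\<dots> = int x'"
      using jsh[of "Suc u"] u by (simp add: key col_tab_apply)
    finally show False using ssh x'(2) by simp
  qed
  then have notin: "T y \<notin> demazure_tableaux n lam \<pi>"
    by (simp add: demazure_tableaux_def)

  \<comment> \<open>The middle tableau as a convex combination\<close>
  define s where "s = (real z' - real y) / (real z' - real x')"
  have s: "0 \<le> s" "s \<le> 1" using x'(2) z'(2) by (auto simp: s_def)
  have sy: "real y = s * real x' + (1 - s) * real z'"
  proof -
    have "s * (real z' - real x') = real z' - real y" using x'(2) z'(2) by (simp add: s_def)
    then show ?thesis by (simp add: algebra_simps)
  qed
  have "real_of_int (T y b') = s * real_of_int (T x' b') + (1 - s) * real_of_int (T z' b')"
    if "b' \<in> shape n lam" for b'
  proof -
    obtain k i where ki: "b' = (k, i)" by force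
    \<comment> \<open>Only position \<open>length xs\<close> depends on \<open>w\<close>, and there
      \<open>s\<close> is the barycentric weight of \<open>x'\<close> in \<open>y\<close>; elsewhere
      the three lists agree, so this one weight serves all boxes.\<close>
    have "real (W y ! u) = s * real (W x' ! u) + (1 - s) * real (W z' ! u)" for u
      using sy by (cases u "length xs" rule: linorder_cases)
        (auto simp: W_def nth_append nth_Cons' algebra_simps)
    then show ?thesis
      using that ki by (cases "k \<le> j") (auto simp: T_def col_tab_apply L_def mem_shape algebra_simps)
  qed
  then show thesis
    using that[of "T x'" "T z'" "T y" s] dem x' z' T2 notin T_key[of y] s
    by (auto simp: principal_ideal_def)
qed

text \<open>Column \<open>lam q\<close> is the last one of length at least \<open>q\<close>. The
  next column is shorter than \<open>q\<close> but at least as long as a column of length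
  \<open>p\<close>, and no column length lies strictly between \<open>p\<close> and
  \<open>q\<close>.\<close>

lemma adjacent_columns:
  assumes "is_partition n lam" "1 \<le> n" "1 \<le> h" "h < num_lens n lam"
  obtains j where "1 \<le> j" "j < lam 1" "col_len n lam j = qq n lam (Suc h)"
    "col_len n lam (Suc j) = qq n lam h"
proof -
  define p where "p = qq n lam h"
  define q where "q = qq n lam (Suc h)"
  have pq: "p \<in> col_lens n lam" "q \<in> col_lens n lam" "p < q"
    using assms by (auto simp: p_def q_def intro: qq_in_col_lens qq_less)
  then obtain k k' where k: "k \<in> {1..lam 1}" "p = col_len n lam k"
    "k' \<in> {1..lam 1}" "q = col_len n lam k'"
    unfolding col_lens_def by blast
  have q1: "1 \<le> q" "q < n"
    using col_lens_pos[OF assms(2) pq(2)] pq(2) by (simp_all add: col_lens_def)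
  define j where "j = lam q"
  have le_iff: "q \<le> col_len n lam i \<longleftrightarrow> i \<le> j" for i
    using le_col_len_iff[OF assms(1), of q i] q1 by (simp add: j_def)
  have "k' \<le> j" using le_iff[of k'] k by simp
  then have j1: "1 \<le> j" "col_len n lam j = q"
    using k col_len_antimono[of k' j n lam] le_iff[of j] by auto
  have "j < k" using le_iff[of k] k pq by simp
  then have j2: "j < lam 1" "p \<le> col_len n lam (Suc j)"
    using k col_len_antimono[of "Suc j" k n lam] by auto
  have lt: "col_len n lam (Suc j) < q" using le_iff[of "Suc j"] by simp
  then have "col_len n lam (Suc j) \<in> col_lens n lam"
    using q1 j2 by (intro col_lensI) auto
  then have "col_len n lam (Suc j) \<le> p"
    unfolding p_def using assms lt by (intro col_lens_less_qq) (auto simp: q_def)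
  with that[of j] j1 j2 show thesis by (simp add: p_def q_def)
qed

theorem theorem11p1:
  fixes n :: nat and lam :: "nat \<Rightarrow> nat" and \<pi> :: "nat \<Rightarrow> nat"
  assumes "1 \<le> n"
    and "is_partition n lam"
    and "lam_permutation n lam \<pi>"
  shows "(demazure_tableaux n lam \<pi> = principal_ideal n lam (lam_key n lam \<pi>)
            \<longrightarrow> lam_312_avoiding n lam \<pi>) \<and>
         (convex_polytope (shape n lam) (demazure_tableaux n lam \<pi>)
            \<longrightarrow> lam_312_avoiding n lam \<pi>)"
proof -
  let ?D = "demazure_tableaux n lam \<pi>"
  \<comment> \<open>Both implications are proved by contraposition from the same
    \<open>T2\<close>.\<close>
  have "?D \<noteq> principal_ideal n lam (lam_key n lam \<pi>) \<and> \<not> convex_polytope (shape n lam) ?D"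
    if con: "lam_312_containing n lam \<pi>"
  proof -
    obtain h a b c where h: "1 \<le> h" "h < num_lens n lam"
      and abc: "1 \<le> a" "a \<le> qq n lam h" "qq n lam h < b" "b \<le> qq n lam (Suc h)"
        "qq n lam (Suc h) < c" "c \<le> n" "\<pi> b < \<pi> c" "\<pi> c < \<pi> a"
      using con unfolding lam_312_containing_def by fastforce
    obtain j where j: "1 \<le> j" "j < lam 1" "col_len n lam j = qq n lam (Suc h)"
      "col_len n lam (Suc j) = qq n lam h"
      using adjacent_columns[OF assms(2,1) h] .
    have perm: "\<pi> permutes {1..n}" using assms(3) by (simp add: lam_permutation_def)
    obtain T1 T2 T3 s where T: "T1 \<in> ?D" "T3 \<in> ?D"
      "T2 \<in> principal_ideal n lam (lam_key n lam \<pi>)" "T2 \<notin> ?D" "0 \<le> s" "s \<le> 1"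
      "\<And>b. b \<in> shape n lam \<Longrightarrow>
        real_of_int (T2 b) = s * real_of_int (T1 b) + (1 - s) * real_of_int (T3 b)"
      using nonconvex_witness[OF assms(1,2) perm j(1,2) j(4)[symmetric] j(3)[symmetric] abc] by metis
    have "T2 \<in> shape n lam \<rightarrow>\<^sub>E UNIV"
      using T(3) by (auto simp: principal_ideal_def tableaux_def PiE_def)
    then have "\<not> convex_polytope (shape n lam) ?D"
      using convex_polytope_segment[of "shape n lam" ?D T1 T3 T2 s] T by blast
    with T show ?thesis by blast
  qed
  then show ?thesis by (auto simp: lam_312_avoiding_def)
qed

end
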